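(* Let $K$ be a field, $S=K[x_1,\ldots,x_n]$, and let $I\subset S$ be a nonzero equigenerated graded ideal. Then: (a) $\mu(I^k)\leq \mu(I^{k+1})$ for all $k\geq 0$. (b) The following conditions are equivalent: (i) $I$ is a principal ideal; (ii) $\mu(I^k)=\mu(I^{k+1})$ for all $k\geq 0$; (iii) $\mu(I^k)=\mu(I^{k+1})$ for some $k\geq 0$.
   Context: $S$ is standard graded. For a graded ideal $L$, $\mu(L)$ is the minimal number of generators of $L$ (and $I^0=S$, $\mu(S)=1$). A graded ideal is equigenerated if it is generated by homogeneous elements all of the same degree. *)

theory Defs
  imports "HOL-Library.Poly_Mapping" "HOL-Algebra.Ideal_Product"
begin

text \<open>
  A monomial is an exponent vector \<open>m :: nat \<Rightarrow>\<^sub>0 nat\<close>, and a polynomial maps monomials to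
  coefficients; multiplication on this type is the convolution product of
  \<^theory>\<open>HOL-Library.Poly_Mapping\<close>.  The type has infinitely many variables, indexed by \<open>nat\<close>;
  the variables \<open>x\<^sub>1, \<dots>, x\<^sub>n\<close> are those with index in \<open>{..<n}\<close>.
\<close>

type_synonym 'k mpoly = "(nat \<Rightarrow>\<^sub>0 nat) \<Rightarrow>\<^sub>0 'k"

definition mpoly_vars :: "'k::zero mpoly \<Rightarrow> nat set" where
  "mpoly_vars p = (\<Union>m \<in> Poly_Mapping.keys p. Poly_Mapping.keys m)"

definition mpoly_ring :: "nat \<Rightarrow> 'k::comm_ring_1 mpoly ring" where
  "mpoly_ring n =
     \<lparr>carrier = {p. mpoly_vars p \<subseteq> {..<n}}, mult = (*), one = 1, zero = 0, add = (+)\<rparr>"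

lemma mpoly_ring_simps [simp]:
  "p \<in> carrier (mpoly_ring n) \<longleftrightarrow> mpoly_vars p \<subseteq> {..<n}"
  "p \<otimes>\<^bsub>mpoly_ring n\<^esub> q = p * q"
  "p \<oplus>\<^bsub>mpoly_ring n\<^esub> q = p + q"
  "\<one>\<^bsub>mpoly_ring n\<^esub> = 1"
  "\<zero>\<^bsub>mpoly_ring n\<^esub> = 0"
  by (simp_all add: mpoly_ring_def)

lemma mpoly_vars_zero [simp]: "mpoly_vars 0 = {}"
  and mpoly_vars_one [simp]: "mpoly_vars (1 :: 'k::comm_ring_1 mpoly) = {}"
  and mpoly_vars_uminus [simp]: "mpoly_vars (- p) = mpoly_vars (p :: 'k::comm_ring_1 mpoly)"
  by (simp_all add: mpoly_vars_def keys.rep_eq[of "- p"] keys.rep_eq[of p])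

lemma mpoly_vars_add: "mpoly_vars (p + q) \<subseteq> mpoly_vars p \<union> mpoly_vars q"
  using Poly_Mapping.keys_add[of p q] unfolding mpoly_vars_def by blast

lemma mpoly_vars_mult: "mpoly_vars (p * q) \<subseteq> mpoly_vars p \<union> mpoly_vars q"
proof
  fix v assume "v \<in> mpoly_vars (p * q)"
  then obtain a b where "a \<in> Poly_Mapping.keys p" "b \<in> Poly_Mapping.keys q"
      and "v \<in> Poly_Mapping.keys (a + b)"
    using keys_mult[of p q] unfolding mpoly_vars_def by blast
  then show "v \<in> mpoly_vars p \<union> mpoly_vars q"
    using Poly_Mapping.keys_add[of a b] unfolding mpoly_vars_def by blast
qed

lemma cring_mpoly_ring: "cring (mpoly_ring n :: 'k::comm_ring_1 mpoly ring)"
proof (rule cringI)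
  have closed: "mpoly_vars (p + q) \<subseteq> {..<n}" "mpoly_vars (p * q) \<subseteq> {..<n}"
    if "mpoly_vars p \<subseteq> {..<n}" "mpoly_vars q \<subseteq> {..<n}" for p q :: "'k mpoly"
    using that mpoly_vars_add[of p q] mpoly_vars_mult[of p q] by blast+
  show "abelian_group (mpoly_ring n :: 'k mpoly ring)"
  proof (rule abelian_groupI)
    fix p assume "p \<in> carrier (mpoly_ring n :: 'k mpoly ring)"
    then show "\<exists>q \<in> carrier (mpoly_ring n). q \<oplus>\<^bsub>mpoly_ring n\<^esub> p = \<zero>\<^bsub>mpoly_ring n\<^esub>"
      by (intro bexI[of _ "- p"]) simp_all
  qed (simp_all add: closed ac_simps)
  show "Group.comm_monoid (mpoly_ring n :: 'k mpoly ring)"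
    by (rule comm_monoidI) (simp_all add: closed ac_simps)
qed (simp add: distrib_right)

text \<open>The standard grading: every variable has degree one.\<close>

definition monom_deg :: "(nat \<Rightarrow>\<^sub>0 nat) \<Rightarrow> nat" where
  "monom_deg m = (\<Sum>v \<in> Poly_Mapping.keys m. Poly_Mapping.lookup m v)"

definition homogeneous :: "nat \<Rightarrow> 'k::zero mpoly \<Rightarrow> bool" where
  "homogeneous d p \<longleftrightarrow> (\<forall>m \<in> Poly_Mapping.keys p. monom_deg m = d)"

definition hom_component :: "nat \<Rightarrow> 'k::comm_monoid_add mpoly \<Rightarrow> 'k mpoly" where
  "hom_component d p =
     (\<Sum>m \<in> {m \<in> Poly_Mapping.keys p. monom_deg m = d}.
        Poly_Mapping.single m (Poly_Mapping.lookup p m))"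

definition graded_ideal :: "nat \<Rightarrow> 'k::comm_ring_1 mpoly set \<Rightarrow> bool" where
  "graded_ideal n L \<longleftrightarrow> ideal L (mpoly_ring n) \<and> (\<forall>p \<in> L. \<forall>d. hom_component d p \<in> L)"

definition equigenerated :: "nat \<Rightarrow> 'k::comm_ring_1 mpoly set \<Rightarrow> bool" where
  "equigenerated n L \<longleftrightarrow>
     (\<exists>d G. G \<subseteq> carrier (mpoly_ring n) \<and> (\<forall>g \<in> G. homogeneous d g) \<and> L = Idl\<^bsub>mpoly_ring n\<^esub> G)"

primrec ideal_power :: "('a, 'b) ring_scheme \<Rightarrow> 'a set \<Rightarrow> nat \<Rightarrow> 'a set" where
  "ideal_power R I 0 = carrier R"
| "ideal_power R I (Suc k) = ideal_power R I k \<cdot>\<^bsub>R\<^esub> I"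

text \<open>The value is only meaningful for finitely generated ideals.\<close>

definition min_gens :: "('a, 'b) ring_scheme \<Rightarrow> 'a set \<Rightarrow> nat" where
  "min_gens R L = (LEAST m. \<exists>G. G \<subseteq> carrier R \<and> finite G \<and> card G = m \<and> L = Idl\<^bsub>R\<^esub> G)"

end

theory Submission
  imports Defs "HOL.Vector_Spaces" "HOL-Library.Set_Algebras"
begin

text \<open>
  Let \<open>G\<close> be a set of generators of \<open>I\<close>, all homogeneous of degree \<open>d\<close>.  The power \<open>I\<^sup>k\<close> is
  generated by the set \<open>G ^ k\<close> of \<open>k\<close>-fold products of elements of \<open>G\<close>
  (\<open>ideal_power_genideal\<close>), all of which are homogeneous of degree \<open>k * d\<close>.  For an ideal
  generated by forms of a single degree, the minimal number of generators is the dimension over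
  the field of the span of these forms (\<open>min_gens_genideal_homogeneous\<close>): the lowest-degree
  components of any generating set must span that space.  The theorem therefore compares the
  dimension of \<open>W = span (G ^ k)\<close> with that of the span of \<open>W * V\<close>, where \<open>V = span G\<close>.

  Multiplication by a nonzero \<open>f \<in> V\<close> embeds \<open>W\<close> into \<open>W * V\<close>, which proves that the numbers of
  generators do not decrease (\<open>dim_le_dim_times\<close>).  If \<open>I\<close> is not principal, then \<open>V\<close> has
  dimension at least two and Gaussian elimination gives nonzero \<open>f, g \<in> V\<close> with
  \<open>leading_monomial f < leading_monomial g\<close>.  Choose \<open>w \<in> W\<close> with the largest leading monomial.
  By multiplicativity of leading monomials, \<open>g * w\<close> has a larger leading monomial than every
  element of \<open>f * W\<close>; hence the embedding is not onto, and the number of generators grows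
  strictly at every \<open>k\<close> (\<open>dim_less_dim_times\<close>).  So a single equality forces \<open>I\<close> to be principal.
  Conversely all powers of a nonzero principal ideal are nonzero and principal, and need exactly
  one generator.
\<close>

section \<open>Coefficients of products\<close>

text \<open>
  Only one pair of monomials contributes to the coefficient at \<open>a + b\<close>.  This happens at both
  ends of a polynomial: for the product of the leading monomials, and for the constant term of
  one factor against a monomial of lowest degree of the other.
\<close>

lemma lookup_mult_unique_decomposition:
  fixes p q :: "'a::monoid_add \<Rightarrow>\<^sub>0 'b::semiring_0"
  assumes "\<And>a' b'. a' \<in> Poly_Mapping.keys p \<Longrightarrow> b' \<in> Poly_Mapping.keys q \<Longrightarrow> a' + b' = a + b
              \<Longrightarrow> a' = a \<and> b' = b"
  shows "Poly_Mapping.lookup (p * q) (a + b) = Poly_Mapping.lookup p a * Poly_Mapping.lookup q b"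
proof -
  have inner: "(Poly_Mapping.lookup q b' when a + b = a' + b') =
      (Poly_Mapping.lookup q b' when a' = a \<and> b' = b)"
    if "a' \<in> Poly_Mapping.keys p" for a' b'
    using assms[OF that, of b'] by (cases "b' \<in> Poly_Mapping.keys q") (auto simp: when_def in_keys_iff)
  have "Poly_Mapping.lookup p a' * (\<Sum>b'. Poly_Mapping.lookup q b' when a + b = a' + b') =
      (Poly_Mapping.lookup p a * Poly_Mapping.lookup q b when a' = a)" for a'
  proof (cases "a' \<in> Poly_Mapping.keys p")
    case True
    show ?thesis
      unfolding inner[OF True] by (cases "a' = a") (simp_all add: when_def)
  next
    case False
    then show ?thesis by (auto simp: in_keys_iff when_def)
  qed
  then show ?thesis
    by (simp add: lookup_mult)
qed

section \<open>The standard grading\<close>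

lemma monom_deg_eq_sum:
  assumes "finite S" "Poly_Mapping.keys m \<subseteq> S"
  shows "monom_deg m = (\<Sum>v\<in>S. Poly_Mapping.lookup m v)"
  unfolding monom_deg_def using assms
  by (intro sum.mono_neutral_left) (auto simp: in_keys_iff)

lemma monom_deg_add: "monom_deg (a + b) = monom_deg a + monom_deg b"
proof -
  let ?S = "Poly_Mapping.keys a \<union> Poly_Mapping.keys b"
  have "Poly_Mapping.keys (a + b) \<subseteq> ?S" by (rule Poly_Mapping.keys_add)
  then show ?thesis
    by (simp add: monom_deg_eq_sum[of ?S] lookup_add sum.distrib)
qed

lemma monom_deg_eq_0_iff: "monom_deg m = 0 \<longleftrightarrow> m = 0"
proof
  assume "monom_deg m = 0"
  then have "\<forall>v. Poly_Mapping.lookup m v = 0"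
    unfolding monom_deg_def by (auto simp: in_keys_iff)
  then show "m = 0" by (intro poly_mapping_eqI) simp
qed (simp add: monom_deg_def)

lemma lookup_hom_component:
  "Poly_Mapping.lookup (hom_component d p) m = (Poly_Mapping.lookup p m when monom_deg m = d)"
  unfolding hom_component_def lookup_sum lookup_single when_def
  by (simp add: in_keys_iff)

text \<open>
  In finitely many variables the forms of a fixed degree make up a finite-dimensional space, so
  dimensions below are meaningful even when the given set of generators is infinite.
\<close>

lemma finite_monomials_of_degree:
  "finite {m. Poly_Mapping.keys m \<subseteq> {..<n} \<and> monom_deg m = d}" (is "finite ?M")
proof (rule inj_on_finite)
  show "inj_on Poly_Mapping.lookup ?M"
    by (simp add: inj_on_def)
  show "finite {f. \<forall>x. (x \<in> {..<n} \<longrightarrow> f x \<in> {..d}) \<and> (x \<notin> {..<n} \<longrightarrow> f x = (0::nat))}"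
    by (intro finite_set_of_finite_funs) simp_all
  show "Poly_Mapping.lookup ` ?M \<subseteq> {f. \<forall>x. (x \<in> {..<n} \<longrightarrow> f x \<in> {..d}) \<and> (x \<notin> {..<n} \<longrightarrow> f x = 0)}"
  proof (clarify, intro conjI impI)
    fix m :: "nat \<Rightarrow>\<^sub>0 nat" and x
    assume m: "Poly_Mapping.keys m \<subseteq> {..<n}"
    show "x \<in> {..<n} \<Longrightarrow> Poly_Mapping.lookup m x \<in> {..monom_deg m}"
      using m by (simp add: monom_deg_eq_sum[of "{..<n}" m] member_le_sum)
    show "x \<notin> {..<n} \<Longrightarrow> Poly_Mapping.lookup m x = 0"
      using m by (meson in_keys_iff subsetD)
  qed
qed

section \<open>Polynomials as a vector space over the field\<close>

definition scale :: "'k \<Rightarrow> 'k::field mpoly \<Rightarrow> 'k mpoly" where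
  "scale c p = Poly_Mapping.single 0 c * p"

global_interpretation poly: vector_space scale
proof
  show "scale a (scale b p) = scale (a * b) p" for a b and p :: "'a mpoly"
    by (simp add: scale_def mult_single flip: mult.assoc)
qed (simp_all add: scale_def distrib_left distrib_right single_add)

lemma lookup_scale [simp]:
  fixes p :: "'a::field mpoly"
  shows "Poly_Mapping.lookup (scale c p) m = c * Poly_Mapping.lookup p m"
proof -
  have "Poly_Mapping.lookup (Poly_Mapping.single 0 c * p) (0 + m) =
      Poly_Mapping.lookup (Poly_Mapping.single 0 c :: 'a mpoly) 0 * Poly_Mapping.lookup p m"
    by (rule lookup_mult_unique_decomposition) (auto split: if_splits)
  then show ?thesis by (simp add: scale_def)
qed

lemma times_scale: "p * scale c q = scale c (p * q)"
  by (simp add: scale_def ac_simps)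

global_interpretation poly_times: Vector_Spaces.linear scale scale "(*) p" for p
  by (simp add: Vector_Spaces.linear_iff poly.vector_space_axioms distrib_left times_scale)

global_interpretation poly_component: Vector_Spaces.linear scale scale "hom_component d" for d
  by (auto simp: Vector_Spaces.linear_iff poly.vector_space_axioms lookup_hom_component lookup_add
      when_def intro!: poly_mapping_eqI)

lemma poly_mapping_eq_sum_single:
  "p = (\<Sum>m\<in>Poly_Mapping.keys p. Poly_Mapping.single m (Poly_Mapping.lookup p m))"
  by (rule poly_mapping_eqI) (simp add: lookup_sum lookup_single when_def in_keys_iff)

lemma homogeneous_in_span_monomials:
  fixes A :: "'k::field mpoly set"
  assumes "A \<subseteq> carrier (mpoly_ring n)" "\<forall>p\<in>A. homogeneous d p"
  shows "A \<subseteq> poly.span ((\<lambda>m. Poly_Mapping.single m 1) `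
           {m. Poly_Mapping.keys m \<subseteq> {..<n} \<and> monom_deg m = d})" (is "_ \<subseteq> poly.span ?F")
proof
  fix p assume p: "p \<in> A"
  have "Poly_Mapping.single m (Poly_Mapping.lookup p m) \<in> poly.span ?F"
    if "m \<in> Poly_Mapping.keys p" for m
  proof -
    have "Poly_Mapping.single m 1 \<in> ?F"
      using assms p that by (fastforce simp: mpoly_vars_def homogeneous_def)
    then have "scale (Poly_Mapping.lookup p m) (Poly_Mapping.single m 1) \<in> poly.span ?F"
      by (intro poly.span_scale poly.span_base)
    then show ?thesis by (simp add: scale_def mult_single)
  qed
  then show "p \<in> poly.span ?F"
    by (subst poly_mapping_eq_sum_single) (rule poly.span_sum)
qed

section \<open>Ideals and products of ideals\<close>

interpretation mpoly: cring "mpoly_ring n :: 'k::comm_ring_1 mpoly ring" for n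
  by (rule cring_mpoly_ring)

lemma ideal_mpoly_subspace:
  fixes L :: "'k::field mpoly set"
  assumes "ideal L (mpoly_ring n)"
  shows "poly.subspace L"
proof -
  interpret ideal L "mpoly_ring n" by fact
  show ?thesis
  proof (rule poly.subspaceI)
    show "0 \<in> L" using zero_closed by simp
    show "p + q \<in> L" if "p \<in> L" "q \<in> L" for p q using a_closed[OF that] by simp
    show "scale c p \<in> L" if "p \<in> L" for c p
    proof -
      have "Poly_Mapping.single 0 c \<in> carrier (mpoly_ring n)"
        by (simp add: mpoly_vars_def)
      from I_l_closed[OF that this] show ?thesis by (simp add: scale_def)
    qed
  qed
qed

lemma (in ring) genideal_eq_if_mutual:
  assumes "A \<subseteq> carrier R" "B \<subseteq> carrier R" "A \<subseteq> Idl B" "B \<subseteq> Idl A"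
  shows "Idl A = Idl B"
  using assms by (intro equalityI genideal_minimal genideal_ideal)

text \<open>
  Closure under negation comes for free, since \<open>- x\<close> is the multiple of \<open>x\<close> by \<open>- 1\<close>.
\<close>

lemma (in cring) ideal_if_closed:
  assumes "N \<subseteq> carrier R" "\<zero> \<in> N"
    and add: "\<And>x y. x \<in> N \<Longrightarrow> y \<in> N \<Longrightarrow> x \<oplus> y \<in> N"
    and mult: "\<And>a x. a \<in> carrier R \<Longrightarrow> x \<in> N \<Longrightarrow> a \<otimes> x \<in> N"
  shows "ideal N R"
proof (rule idealI[OF ring_axioms])
  show "subgroup N (add_monoid R)"
  proof (rule add.subgroupI)
    show "\<ominus> x \<in> N" if x: "x \<in> N" for x
    proof -
      have "\<ominus> x = (\<ominus> \<one>) \<otimes> x"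
        using x assms(1) by (simp add: l_minus subset_iff)
      then show ?thesis
        using mult[OF _ x, of "\<ominus> \<one>"] by simp
    qed
  qed (use assms in auto)
  show "a \<otimes> x \<in> N" "x \<otimes> a \<in> N" if "x \<in> N" "a \<in> carrier R" for a x
    using that mult m_comm[of x a] assms(1) by auto
qed

text \<open>
  For fixed \<open>b\<close>, the elements \<open>x\<close> with \<open>x * b\<close> in a given ideal form an ideal.  This passes from
  generators to all elements, first in the left factor and then in the right one.
\<close>

lemma (in cring) ideal_prod_genideal:
  assumes A: "A \<subseteq> carrier R" and B: "B \<subseteq> carrier R"
  shows "(Idl A) \<cdot> (Idl B) = Idl (A <#> B)"
proof
  have AB: "A <#> B \<subseteq> carrier R"
    using A B by (rule set_mult_closed)
  interpret J: ideal "Idl (A <#> B)" R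
    using AB by (rule genideal_ideal)
  have colon: "ideal {x \<in> carrier R. x \<otimes> b \<in> Idl (A <#> B)} R" if "b \<in> carrier R" for b
    using that by (intro ideal_if_closed) (auto simp: l_distr m_assoc J.I_l_closed)
  have one_side: "x \<otimes> b \<in> Idl (A <#> B)" if "x \<in> Idl A" "b \<in> B" for x b
  proof -
    have "A \<subseteq> {x \<in> carrier R. x \<otimes> b \<in> Idl (A <#> B)}"
      using A genideal_self[OF AB] that by (auto simp: set_mult_def)
    then show ?thesis
      using genideal_minimal[OF colon] that B by blast
  qed
  have "y \<otimes> x \<in> Idl (A <#> B)" if "x \<in> Idl A" "y \<in> Idl B" for x y
  proof -
    have x: "x \<in> carrier R"
      using that genideal_ideal[OF A] by (auto dest: ideal.Icarr)
    have "B \<subseteq> {y \<in> carrier R. y \<otimes> x \<in> Idl (A <#> B)}"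
      using B x one_side[OF \<open>x \<in> Idl A\<close>] by (auto simp: m_comm subset_iff)
    then show ?thesis
      using genideal_minimal[OF colon[OF x]] that by blast
  qed
  then have "x \<otimes> y \<in> Idl (A <#> B)" if "x \<in> Idl A" "y \<in> Idl B" for x y
    using that m_comm ideal.Icarr[OF genideal_ideal[OF A]] ideal.Icarr[OF genideal_ideal[OF B]]
    by metis
  then have "(Idl A) <#> (Idl B) \<subseteq> Idl (A <#> B)"
    unfolding set_mult_def by blast
  then show "(Idl A) \<cdot> (Idl B) \<subseteq> Idl (A <#> B)"
    unfolding ideal_prod_eq_genideal[OF genideal_ideal[OF A] genideal_ideal[OF B]]
    by (intro genideal_minimal J.is_ideal)
  have "A <#> B \<subseteq> (Idl A) \<cdot> (Idl B)"
    using genideal_self[OF A] genideal_self[OF B]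
    by (auto simp: set_mult_def intro!: ideal_prod.prod)
  then show "Idl (A <#> B) \<subseteq> (Idl A) \<cdot> (Idl B)"
    by (intro genideal_minimal ideal_prod_is_ideal genideal_ideal A B)
qed

section \<open>Minimal generators of an equigenerated ideal\<close>

text \<open>
  If \<open>g\<close> has no terms of degree less than \<open>e\<close>, then only the constant term of \<open>a\<close> contributes to
  the component of \<open>a * g\<close> of degree \<open>e\<close>.  So in the lowest degree, combinations with polynomial
  coefficients reduce to linear combinations over the field.  Formally, the polynomials that
  satisfy both conclusions form an ideal, which contains \<open>G\<close>.
\<close>

lemma ideal_above_degree:
  fixes G :: "'k::field mpoly set"
  assumes G: "G \<subseteq> carrier (mpoly_ring n)"
    and low: "\<And>g m. g \<in> G \<Longrightarrow> m \<in> Poly_Mapping.keys g \<Longrightarrow> e \<le> monom_deg m"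
    and p: "p \<in> Idl\<^bsub>mpoly_ring n\<^esub> G"
  shows "\<forall>m\<in>Poly_Mapping.keys p. e \<le> monom_deg m"
    and "hom_component e p \<in> poly.span (hom_component e ` G)"
proof -
  let ?N = "{p \<in> carrier (mpoly_ring n). (\<forall>m\<in>Poly_Mapping.keys p. e \<le> monom_deg m) \<and>
              hom_component e p \<in> poly.span (hom_component e ` G)}"
  have low_mult: "hom_component e (a * g) = scale (Poly_Mapping.lookup a 0) (hom_component e g)"
    if "\<forall>m\<in>Poly_Mapping.keys g. e \<le> monom_deg m" for a g :: "'k mpoly"
  proof (rule poly_mapping_eqI)
    fix m
    show "Poly_Mapping.lookup (hom_component e (a * g)) m =
        Poly_Mapping.lookup (scale (Poly_Mapping.lookup a 0) (hom_component e g)) m"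
    proof (cases "monom_deg m = e")
      case True
      have "a' = 0 \<and> b' = m" if "b' \<in> Poly_Mapping.keys g" "a' + b' = 0 + m" for a' b'
      proof -
        have "monom_deg a' + monom_deg b' = e"
          using that True by (metis add_0 monom_deg_add)
        moreover have "e \<le> monom_deg b'"
          using that \<open>\<forall>m\<in>Poly_Mapping.keys g. e \<le> monom_deg m\<close> by blast
        ultimately have "a' = 0" by (simp flip: monom_deg_eq_0_iff)
        then show ?thesis using that by simp
      qed
      then show ?thesis
        using lookup_mult_unique_decomposition[of a g 0 m] True
        by (simp add: lookup_hom_component)
    qed (simp add: lookup_hom_component)
  qed
  have mult_closed: "a * p \<in> ?N" if "p \<in> ?N" "a \<in> carrier (mpoly_ring n)" for a p :: "'k mpoly"
  proof -
    have "e \<le> monom_deg m" if m: "m \<in> Poly_Mapping.keys (a * p)" for m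
      using keys_mult[of a p] m \<open>p \<in> ?N\<close> by (fastforce simp: monom_deg_add)
    moreover have "a * p \<in> carrier (mpoly_ring n)"
      using that mpoly.m_closed[of a n p] by (simp del: mpoly_ring_simps(1))
    ultimately show ?thesis
      using that low_mult[of p a] by (auto intro: poly.span_scale)
  qed
  have add_closed: "p + q \<in> ?N" if "p \<in> ?N" "q \<in> ?N" for p q
  proof -
    have "p + q \<in> carrier (mpoly_ring n)"
      using that mpoly.a_closed[of p n q] by (simp del: mpoly_ring_simps(1))
    then show ?thesis
      using that Poly_Mapping.keys_add[of p q] by (auto simp: poly_component.add intro: poly.span_add)
  qed
  have "ideal ?N (mpoly_ring n)"
  proof (rule mpoly.ideal_if_closed)
    show "\<zero>\<^bsub>mpoly_ring n\<^esub> \<in> ?N" by (simp add: poly.span_zero)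
    show "p \<oplus>\<^bsub>mpoly_ring n\<^esub> q \<in> ?N" if "p \<in> ?N" "q \<in> ?N" for p q
      using add_closed[OF that] by (simp only: mpoly_ring_simps(3))
    show "a \<otimes>\<^bsub>mpoly_ring n\<^esub> p \<in> ?N" if "a \<in> carrier (mpoly_ring n)" "p \<in> ?N" for a p
      using mult_closed[OF that(2,1)] by (simp only: mpoly_ring_simps(2))
  qed blast
  moreover have "G \<subseteq> ?N"
    using G low by (auto simp del: mpoly_ring_simps(1) intro: poly.span_base)
  ultimately have "p \<in> ?N"
    using mpoly.genideal_minimal[of ?N n G] p by blast
  then show "\<forall>m\<in>Poly_Mapping.keys p. e \<le> monom_deg m"
    and "hom_component e p \<in> poly.span (hom_component e ` G)"
    by simp_all
qed

lemma hom_component_homogeneous: "homogeneous e p \<Longrightarrow> hom_component e p = p"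
  by (rule poly_mapping_eqI) (auto simp: lookup_hom_component homogeneous_def when_def in_keys_iff)

text \<open>
  A basis chosen from \<open>A\<close> generates the ideal.  Conversely, for any finite set \<open>G\<close> that generates
  it, the components of degree \<open>e\<close> of the elements of \<open>G\<close> span a space that contains \<open>A\<close>.
\<close>

lemma min_gens_genideal_homogeneous:
  fixes A :: "'k::field mpoly set"
  assumes A: "A \<subseteq> carrier (mpoly_ring n)" and hom: "\<forall>p\<in>A. homogeneous e p"
  shows "min_gens (mpoly_ring n) (Idl\<^bsub>mpoly_ring n\<^esub> A) = poly.dim A"
  unfolding min_gens_def
proof (rule Least_equality)
  obtain B where B: "B \<subseteq> A" "poly.independent B" "A \<subseteq> poly.span B" "card B = poly.dim A"
    by (rule poly.basis_exists)
  have "finite B"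
    using poly.independent_span_bound[OF finite_imageI[OF finite_monomials_of_degree] B(2)]
      homogeneous_in_span_monomials[OF A hom] B(1) by blast
  moreover have "Idl\<^bsub>mpoly_ring n\<^esub> A = Idl\<^bsub>mpoly_ring n\<^esub> B"
  proof (rule mpoly.genideal_eq_if_mutual)
    have B_carrier: "B \<subseteq> carrier (mpoly_ring n)" using A B(1) by blast
    then have "poly.span B \<subseteq> Idl\<^bsub>mpoly_ring n\<^esub> B"
      by (intro poly.span_minimal mpoly.genideal_self ideal_mpoly_subspace[OF mpoly.genideal_ideal])
    then show "A \<subseteq> Idl\<^bsub>mpoly_ring n\<^esub> B" using B(3) by blast
    show "B \<subseteq> Idl\<^bsub>mpoly_ring n\<^esub> A" using mpoly.genideal_self[OF A] B(1) by blast
  qed (use A B(1) in auto)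
  ultimately show "\<exists>G\<subseteq>carrier (mpoly_ring n). finite G \<and> card G = poly.dim A \<and>
      Idl\<^bsub>mpoly_ring n\<^esub> A = Idl\<^bsub>mpoly_ring n\<^esub> G"
    using A B by blast
next
  fix m
  assume "\<exists>G\<subseteq>carrier (mpoly_ring n). finite G \<and> card G = m \<and>
      Idl\<^bsub>mpoly_ring n\<^esub> A = Idl\<^bsub>mpoly_ring n\<^esub> G"
  then obtain G where G: "G \<subseteq> carrier (mpoly_ring n)" "finite G" "card G = m"
    and eq: "Idl\<^bsub>mpoly_ring n\<^esub> A = Idl\<^bsub>mpoly_ring n\<^esub> G" by blast
  have low: "e \<le> monom_deg u" if "g \<in> G" "u \<in> Poly_Mapping.keys g" for g u
  proof -
    have "g \<in> Idl\<^bsub>mpoly_ring n\<^esub> A"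
      using mpoly.genideal_self[OF G(1)] eq that(1) by blast
    moreover have "e \<le> monom_deg u'" if "a \<in> A" "u' \<in> Poly_Mapping.keys a" for a u'
      using hom that by (auto simp: homogeneous_def)
    ultimately show ?thesis
      using ideal_above_degree(1)[OF A] that(2) by blast
  qed
  have "hom_component e p \<in> poly.span (hom_component e ` G)" if "p \<in> A" for p
    by (rule ideal_above_degree(2)[OF G(1) low]) (use mpoly.genideal_self[OF A] eq that in auto)
  then have "A \<subseteq> poly.span (hom_component e ` G)"
    using hom by (metis hom_component_homogeneous subsetI)
  then have "poly.dim A \<le> card (hom_component e ` G)"
    using G(2) by (intro poly.dim_le_card) simp_all
  then show "poly.dim A \<le> m"
    using card_image_le[OF G(2), of "hom_component e"] G(3) by simp
qed

section \<open>Generators of the powers of an ideal\<close>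

lemma set_mult_mpoly_ring: "A <#>\<^bsub>mpoly_ring n\<^esub> B = A * B"
  by (auto simp: set_mult_def set_times_def)

lemma set_power_closed: "G \<subseteq> carrier (mpoly_ring n) \<Longrightarrow> G ^ k \<subseteq> carrier (mpoly_ring n)"
proof (induction k)
  case 0
  show ?case using mpoly.one_closed[of n] by (simp only: power_0 set_one mpoly_ring_simps(4)) blast
next
  case (Suc k)
  then show ?case
    using mpoly.set_mult_closed[of G n "G ^ k"] by (simp only: set_mult_mpoly_ring power_Suc)
qed

lemma ideal_power_genideal:
  assumes "G \<subseteq> carrier (mpoly_ring n)"
  shows "ideal_power (mpoly_ring n) (Idl\<^bsub>mpoly_ring n\<^esub> G) k = Idl\<^bsub>mpoly_ring n\<^esub> (G ^ k)"
proof (induction k)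
  case 0
  show ?case
    by (simp only: power_0 set_one ideal_power.simps(1) mpoly.genideal_one[unfolded mpoly_ring_simps])
next
  case (Suc k)
  then show ?case
    using mpoly.ideal_prod_genideal[OF set_power_closed[OF assms] assms]
    by (simp only: ideal_power.simps(2) set_mult_mpoly_ring power_Suc2)
qed

lemma homogeneous_mult:
  assumes "homogeneous d p" "homogeneous e q"
  shows "homogeneous (d + e) (p * q)"
  unfolding homogeneous_def
proof
  fix m
  assume "m \<in> Poly_Mapping.keys (p * q)"
  then obtain a b where "a \<in> Poly_Mapping.keys p" "b \<in> Poly_Mapping.keys q" "m = a + b"
    using keys_mult[of p q] by blast
  then show "monom_deg m = d + e"
    using assms by (simp add: homogeneous_def monom_deg_add)
qed

lemma homogeneous_set_power:
  assumes "\<forall>g\<in>G. homogeneous d g"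
  shows "\<forall>p\<in>G ^ k. homogeneous (k * d) p"
proof (induction k)
  case 0
  then show ?case by (simp add: homogeneous_def monom_deg_def)
next
  case (Suc k)
  then show ?case
    using assms by (auto simp: set_times_def intro!: homogeneous_mult)
qed

section \<open>Leading monomials\<close>

text \<open>
  Monomials are compared lexicographically by the linear order on finitely supported functions.
  Any total order compatible with the addition of exponents would serve.
\<close>

abbreviation leading_monomial :: "'k::zero mpoly \<Rightarrow> (nat \<Rightarrow>\<^sub>0 nat)" where
  "leading_monomial p \<equiv> Max (Poly_Mapping.keys p)"

lemma lookup_leading_monomial: "p \<noteq> 0 \<Longrightarrow> Poly_Mapping.lookup p (leading_monomial p) \<noteq> 0"
  using Max_in[of "Poly_Mapping.keys p"] by (simp add: in_keys_iff)

lemma leading_monomial_mult: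
  fixes p q :: "'k::field mpoly"
  assumes "p \<noteq> 0" "q \<noteq> 0"
  shows "leading_monomial (p * q) = leading_monomial p + leading_monomial q"
proof (rule Max_eqI)
  have eq: "a = leading_monomial p \<and> b = leading_monomial q"
    if "a \<in> Poly_Mapping.keys p" "b \<in> Poly_Mapping.keys q"
      "a + b = leading_monomial p + leading_monomial q" for a b
  proof -
    have "a \<le> leading_monomial p" "b \<le> leading_monomial q"
      using that by simp_all
    then show ?thesis
      using that(3) add_less_le_mono[of a "leading_monomial p" b "leading_monomial q"]
        add_le_less_mono[of a "leading_monomial p" b "leading_monomial q"]
      by (auto simp: order.order_iff_strict)
  qed
  show "leading_monomial p + leading_monomial q \<in> Poly_Mapping.keys (p * q)"
  proof -
    have "Poly_Mapping.lookup (p * q) (leading_monomial p + leading_monomial q) =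
        Poly_Mapping.lookup p (leading_monomial p) * Poly_Mapping.lookup q (leading_monomial q)"
      by (rule lookup_mult_unique_decomposition) (rule eq)
    then show ?thesis
      using assms by (simp add: in_keys_iff lookup_leading_monomial)
  qed
  show "c \<le> leading_monomial p + leading_monomial q" if c: "c \<in> Poly_Mapping.keys (p * q)" for c
  proof -
    obtain a b where "a \<in> Poly_Mapping.keys p" "b \<in> Poly_Mapping.keys q" "c = a + b"
      using keys_mult[of p q] c by blast
    then show ?thesis by (simp add: add_mono)
  qed
qed simp

text \<open>
  One step of Gaussian elimination: when \<open>f\<close> and \<open>g\<close> have the same leading monomial, subtract from
  \<open>g\<close> the multiple of \<open>f\<close> that cancels it.
\<close>

lemma span_distinct_leading_monomials:
  fixes f g :: "'k::field mpoly"
  assumes "f \<noteq> 0" "g \<notin> poly.span {f}"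
  obtains f' g' where "f' \<in> poly.span {f, g}" "g' \<in> poly.span {f, g}" "f' \<noteq> 0" "g' \<noteq> 0"
    "leading_monomial f' < leading_monomial g'"
proof -
  have f: "f \<in> poly.span {f, g}" and g: "g \<in> poly.span {f, g}" "g \<noteq> 0"
    using assms poly.span_base[of _ "{f, g}"] poly.span_zero by auto
  show ?thesis
  proof (cases "leading_monomial f = leading_monomial g")
    case False
    then show ?thesis
      using that[OF f g(1)] that[OF g(1) f] assms(1) g(2) by (metis linorder_neqE)
  next
    case True
    let ?m = "leading_monomial f"
    define c where "c = Poly_Mapping.lookup g ?m / Poly_Mapping.lookup f ?m"
    define h where "h = g - scale c f"
    have h: "h \<in> poly.span {f, g}"
      unfolding h_def by (intro poly.span_diff poly.span_scale f g)
    have "h \<noteq> 0"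
      using assms(2) poly.span_scale[OF poly.span_base[of f "{f}"], of c] by (auto simp: h_def)
    have "Poly_Mapping.lookup h ?m = 0"
      using lookup_leading_monomial[OF assms(1)] by (simp add: h_def lookup_minus c_def)
    then have "leading_monomial h \<noteq> ?m"
      using lookup_leading_monomial[OF \<open>h \<noteq> 0\<close>] by metis
    moreover have "leading_monomial h \<le> ?m"
    proof -
      have "leading_monomial h \<in> Poly_Mapping.keys g \<union> Poly_Mapping.keys f"
        using lookup_leading_monomial[OF \<open>h \<noteq> 0\<close>] by (auto simp: h_def lookup_minus in_keys_iff)
      then show ?thesis
        using True Max_ge[OF finite_keys, of _ f] Max_ge[OF finite_keys, of _ g] by auto
    qed
    ultimately show ?thesis
      using that[OF h f \<open>h \<noteq> 0\<close> assms(1)] by simp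
  qed
qed

section \<open>The dimension of a product of spaces\<close>

lemma times_in_span_times:
  assumes "p \<in> poly.span A" "q \<in> poly.span B"
  shows "p * q \<in> poly.span (A * B)"
proof -
  have "a * q \<in> poly.span (A * B)" if "a \<in> A" for a
  proof -
    have "(*) a ` B \<subseteq> A * B" using that by auto
    then show ?thesis
      using poly_times.span_image[of a B] assms(2) poly.span_mono by blast
  qed
  then have "(*) q ` A \<subseteq> poly.span (A * B)"
    by (auto simp: mult.commute)
  then have "(*) q ` poly.span A \<subseteq> poly.span (A * B)"
    unfolding poly_times.span_image[symmetric] by (rule poly.span_minimal[OF _ poly.subspace_span])
  then show ?thesis
    using assms(1) by (auto simp: mult.commute)
qed

lemma finite_independent_card_le_dim:
  assumes "finite F" "V \<subseteq> poly.span F" and S: "poly.independent S" "S \<subseteq> poly.span V"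
  shows "finite S \<and> card S \<le> poly.dim V"
proof -
  obtain B where B: "B \<subseteq> V" "poly.independent B" "V \<subseteq> poly.span B" "card B = poly.dim V"
    by (rule poly.basis_exists)
  have "finite B"
    using poly.independent_span_bound[OF assms(1) B(2)] assms(2) B(1) by blast
  moreover have "S \<subseteq> poly.span B"
    using S(2) poly.span_minimal[OF B(3) poly.subspace_span] by blast
  ultimately show ?thesis
    using poly.independent_span_bound[OF _ S(1)] B(4) by metis
qed

text \<open>
  Multiplication by \<open>f\<close> is injective because polynomials form a domain, so it carries a basis of
  \<open>A\<close> to an independent subset of the span of \<open>A * B\<close>.
\<close>

lemma times_basis:
  fixes A B :: "'k::field mpoly set"
  assumes F: "finite F" "A * B \<subseteq> poly.span F" and f: "f \<in> poly.span B" "f \<noteq> 0"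
  obtains P where "finite P" "poly.span P = poly.span A" "poly.independent ((*) f ` P)"
    "(*) f ` P \<subseteq> poly.span (A * B)" "card ((*) f ` P) = poly.dim A"
proof -
  obtain P where P: "P \<subseteq> A" "poly.independent P" "A \<subseteq> poly.span P" "card P = poly.dim A"
    by (rule poly.basis_exists)
  have inj: "inj_on ((*) f) X" for X
    using f(2) by (simp add: inj_on_def)
  have indep: "poly.independent ((*) f ` P)"
    using P(2) inj by (rule poly_times.independent_injective_image)
  have sub: "(*) f ` P \<subseteq> poly.span (A * B)"
    using P(1) f(1) times_in_span_times[of _ A f B] poly.span_base by (auto simp: mult.commute)
  have "finite P"
    using finite_independent_card_le_dim[OF F indep sub] finite_image_iff[OF inj] by blast
  moreover have "poly.span P = poly.span A"
    using poly.span_mono[OF P(1)] poly.span_minimal[OF P(3) poly.subspace_span] by blast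
  moreover have "card ((*) f ` P) = poly.dim A"
    using P(4) card_image[OF inj] by simp
  ultimately show ?thesis
    using indep sub that by blast
qed

lemma dim_le_dim_times:
  fixes A B :: "'k::field mpoly set"
  assumes F: "finite F" "A * B \<subseteq> poly.span F" and f: "f \<in> poly.span B" "f \<noteq> 0"
  shows "poly.dim A \<le> poly.dim (A * B)"
  using times_basis[OF assms] finite_independent_card_le_dim[OF F] by metis

text \<open>
  Let \<open>w\<close> have the largest leading monomial in the span of \<open>A\<close>.  Then \<open>g * w\<close> lies outside \<open>f\<close>
  times that span, since its leading monomial is too large, and it extends the independent set of
  the previous argument by one element.
\<close>

lemma dim_less_dim_times:
  fixes A B :: "'k::field mpoly set"
  assumes F: "finite F" "A * B \<subseteq> poly.span F"
    and f: "f \<in> poly.span B" "f \<noteq> 0" and g: "g \<in> poly.span B" "g \<noteq> 0"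
    and less: "leading_monomial f < leading_monomial g"
    and a: "a \<in> A" "a \<noteq> 0"
  shows "poly.dim A < poly.dim (A * B)"
proof -
  obtain P where P: "finite P" "poly.span P = poly.span A" "poly.independent ((*) f ` P)"
    "(*) f ` P \<subseteq> poly.span (A * B)" "card ((*) f ` P) = poly.dim A"
    using times_basis[OF F f] by blast
  let ?L = "leading_monomial ` (poly.span A - {0})"
  \<comment> \<open>The largest leading monomial exists: all monomials occurring in the span of \<open>A\<close> occur
    already in the finite set \<open>P\<close>.\<close>
  have keys: "Poly_Mapping.keys w \<subseteq> (\<Union>p\<in>P. Poly_Mapping.keys p)" if "w \<in> poly.span P" for w
    using that
  proof (induction w rule: poly.span_induct_alt)
    case (step c p w)
    have "Poly_Mapping.keys (scale c p) \<subseteq> Poly_Mapping.keys p"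
      by (auto simp: in_keys_iff)
    then show ?case
      using step Poly_Mapping.keys_add[of "scale c p" w] by blast
  qed simp
  have "?L \<subseteq> (\<Union>p\<in>P. Poly_Mapping.keys p)"
    using keys P(2) Max_in[of "Poly_Mapping.keys _"] by fastforce
  then have fin: "finite ?L"
    by (rule finite_subset) (simp add: P(1))
  moreover have "?L \<noteq> {}"
    using a poly.span_base by blast
  ultimately have "Max ?L \<in> ?L" by (rule Max_in)
  then obtain w where "w \<in> poly.span A - {0}" "Max ?L = leading_monomial w"
    by (rule imageE)
  then have w: "w \<in> poly.span A" "w \<noteq> 0" "leading_monomial w = Max ?L"
    by simp_all
  have "g * w \<notin> poly.span ((*) f ` P)"
  proof
    assume "g * w \<in> poly.span ((*) f ` P)"
    then obtain u where u: "u \<in> poly.span A" "g * w = f * u"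
      using poly_times.span_image[of f P] P(2) by auto
    then have "u \<noteq> 0" using g(2) w(2) by auto
    then have "leading_monomial u \<le> leading_monomial w"
      using u(1) w(3) fin by simp
    then have "leading_monomial (f * u) < leading_monomial (g * w)"
      using less f(2) g(2) w(2) \<open>u \<noteq> 0\<close> by (simp add: leading_monomial_mult add_less_le_mono)
    then show False using u(2) by simp
  qed
  then have indep: "poly.independent (insert (g * w) ((*) f ` P))" "g * w \<notin> (*) f ` P"
    using P(3) poly.independent_insertI poly.span_base by blast+
  have "insert (g * w) ((*) f ` P) \<subseteq> poly.span (A * B)"
    using P(4) times_in_span_times[OF w(1) g(1)] by (simp add: mult.commute)
  then have "card (insert (g * w) ((*) f ` P)) \<le> poly.dim (A * B)"
    using finite_independent_card_le_dim[OF F indep(1)] by blast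
  then show ?thesis
    using P(1,5) indep(2) by simp
qed

section \<open>Powers of equigenerated ideals\<close>

text \<open>
  A generator of a principal ideal is not assumed homogeneous, so the count of generators through
  dimensions does not apply to it directly.  Here it suffices that no generators give the zero ideal.
\<close>

lemma min_gens_genideal_singleton:
  fixes p :: "'k::field mpoly"
  assumes "p \<in> carrier (mpoly_ring n)" "p \<noteq> 0"
  shows "min_gens (mpoly_ring n) (Idl\<^bsub>mpoly_ring n\<^esub> {p}) = 1"
  unfolding min_gens_def
proof (rule Least_equality)
  show "\<exists>G\<subseteq>carrier (mpoly_ring n). finite G \<and> card G = 1 \<and>
      Idl\<^bsub>mpoly_ring n\<^esub> {p} = Idl\<^bsub>mpoly_ring n\<^esub> G"
    using assms(1) by (intro exI[of _ "{p}"]) simp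
next
  fix m
  assume "\<exists>G\<subseteq>carrier (mpoly_ring n). finite G \<and> card G = m \<and>
      Idl\<^bsub>mpoly_ring n\<^esub> {p} = Idl\<^bsub>mpoly_ring n\<^esub> G"
  then obtain G where G: "finite G" "card G = m" "p \<in> Idl\<^bsub>mpoly_ring n\<^esub> G"
    using mpoly.genideal_self[of "{p}" n] assms(1) by auto
  have "G \<noteq> {}"
  proof
    assume "G = {}"
    then have "p \<in> {0}"
      using G(3) mpoly.genideal_minimal[OF mpoly.zeroideal, of "{}" n] by auto
    then show False using assms(2) by simp
  qed
  then show "1 \<le> m" using G(1,2) by (auto simp: Suc_le_eq card_gt_0_iff)
qed

lemma set_power_singleton: "{p :: 'a::comm_monoid_mult} ^ k = {p ^ k}"
  by (induction k) (auto simp: set_times_def)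

theorem corollary1p2:
  fixes n :: nat and I :: "'k::field mpoly set"
  assumes "graded_ideal n I"
    and "equigenerated n I"
    and "I \<noteq> {\<zero>\<^bsub>mpoly_ring n\<^esub>}"
  shows "(\<forall>k. min_gens (mpoly_ring n) (ideal_power (mpoly_ring n) I k) \<le>
                min_gens (mpoly_ring n) (ideal_power (mpoly_ring n) I (k + 1))) \<and>
         (principalideal I (mpoly_ring n) \<longleftrightarrow>
           (\<forall>k. min_gens (mpoly_ring n) (ideal_power (mpoly_ring n) I k) =
                min_gens (mpoly_ring n) (ideal_power (mpoly_ring n) I (k + 1)))) \<and>
         ((\<forall>k. min_gens (mpoly_ring n) (ideal_power (mpoly_ring n) I k) =
                min_gens (mpoly_ring n) (ideal_power (mpoly_ring n) I (k + 1))) \<longleftrightarrow>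
           (\<exists>k. min_gens (mpoly_ring n) (ideal_power (mpoly_ring n) I k) =
                min_gens (mpoly_ring n) (ideal_power (mpoly_ring n) I (k + 1))))"
proof -
  let ?R = "mpoly_ring n :: 'k mpoly ring"
  let ?\<mu> = "\<lambda>k. min_gens ?R (ideal_power ?R I k)"
  obtain d G where G: "G \<subseteq> carrier ?R" and hom: "\<forall>g\<in>G. homogeneous d g" and I: "I = Idl\<^bsub>?R\<^esub> G"
    using assms(2) by (auto simp: equigenerated_def)
  have \<mu>: "?\<mu> k = poly.dim (G ^ k)" for k
    unfolding I ideal_power_genideal[OF G]
    by (rule min_gens_genideal_homogeneous[OF set_power_closed[OF G] homogeneous_set_power[OF hom]])
  have span: "G ^ k * G \<subseteq> poly.span ((\<lambda>m. Poly_Mapping.single m 1) `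
      {m. Poly_Mapping.keys m \<subseteq> {..<n} \<and> monom_deg m = (k + 1) * d})" for k
    using homogeneous_in_span_monomials[OF set_power_closed[OF G] homogeneous_set_power[OF hom], of "k + 1"]
    by (simp add: mult.commute)
  have fin: "finite ((\<lambda>m. Poly_Mapping.single m (1::'k)) `
      {m. Poly_Mapping.keys m \<subseteq> {..<n} \<and> monom_deg m = (k + 1) * d})" for k
    using finite_monomials_of_degree by (rule finite_imageI)
  obtain f where f: "f \<in> G" "f \<noteq> 0"
  proof (rule ccontr)
    assume "\<not> thesis"
    then have "G \<subseteq> {\<zero>\<^bsub>?R\<^esub>}" using that by auto
    then have "I \<subseteq> {\<zero>\<^bsub>?R\<^esub>}"
      unfolding I by (intro mpoly.genideal_minimal mpoly.zeroideal)
    moreover have "\<zero>\<^bsub>?R\<^esub> \<in> I"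
      unfolding I using mpoly.genideal_ideal[OF G]
      by (intro additive_subgroup.zero_closed ideal.axioms)
    ultimately show False using assms(3) by blast
  qed
  have le: "?\<mu> k \<le> ?\<mu> (k + 1)" for k
    using dim_le_dim_times[OF fin span poly.span_base[OF f(1)] f(2), of k]
    unfolding \<mu> by (simp add: mult.commute)
  have less: "?\<mu> k < ?\<mu> (k + 1)" if np: "\<not> principalideal I ?R" for k
  proof -
    have "\<not> G \<subseteq> poly.span {f}"
    proof
      assume sub: "G \<subseteq> poly.span {f}"
      have f_carrier: "{f} \<subseteq> carrier ?R" using f(1) G by blast
      have "poly.span {f} \<subseteq> Idl\<^bsub>?R\<^esub> {f}"
        using f_carrier
        by (intro poly.span_minimal mpoly.genideal_self ideal_mpoly_subspace[OF mpoly.genideal_ideal])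
      then have "I = Idl\<^bsub>?R\<^esub> {f}"
        unfolding I using G f_carrier sub f(1) mpoly.genideal_self[OF G]
        by (intro mpoly.genideal_eq_if_mutual) auto
      then have "principalideal I ?R"
        using f_carrier mpoly.genideal_ideal[OF f_carrier] by (intro principalidealI) auto
      then show False using np by blast
    qed
    then obtain g where g: "g \<in> G" "g \<notin> poly.span {f}" by blast
    obtain f' g' where fg: "f' \<in> poly.span {f, g}" "g' \<in> poly.span {f, g}" "f' \<noteq> 0" "g' \<noteq> 0"
      "leading_monomial f' < leading_monomial g'"
      using span_distinct_leading_monomials[OF f(2) g(2)] .
    have "poly.span {f, g} \<subseteq> poly.span G"
      using f(1) g(1) by (intro poly.span_mono) auto
    moreover have "{f} ^ k \<subseteq> G ^ k"
      using f(1) by (induction k) (auto simp: set_times_def)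
    then have "f ^ k \<in> G ^ k" by (simp add: set_power_singleton)
    ultimately have "poly.dim (G ^ k) < poly.dim (G ^ k * G)"
      using fg f(2) by (intro dim_less_dim_times[OF fin span, where f = f' and g = g' and a = "f ^ k"]) auto
    then show ?thesis unfolding \<mu> by (simp add: mult.commute)
  qed
  have one: "?\<mu> k = 1" if pr: "principalideal I ?R" for k
  proof -
    obtain i where i: "i \<in> carrier ?R" "I = Idl\<^bsub>?R\<^esub> {i}"
      using principalideal.generate[OF pr] by blast
    have "i \<noteq> 0"
      using assms(3) i(2) mpoly.genideal_zero by auto
    moreover have "{i ^ k} \<subseteq> carrier ?R"
      using set_power_closed[of "{i}" n k] i(1) unfolding set_power_singleton by blast
    ultimately show ?thesis
      using ideal_power_genideal[of "{i}" n k] min_gens_genideal_singleton[of "i ^ k" n] i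
      by (simp add: set_power_singleton)
  qed
  show ?thesis
    using le less one by (metis less_irrefl)
qed

end
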